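(* Let $(\Omega,\Sigma,\mu)$ be a finite positive measure space, let $\Phi$ be a Young function and let $X$ be a quasi-Banach function space over $\mu$. Then the Orlicz space $X^{\Phi}$, equipped with the Luxemburg quasi-norm $\|\cdot\|_{X^{\Phi}}$, is complete (and hence it is a quasi-Banach function space over $\mu$).
   Context: $L^0(\mu)$ is the space of ($\mu$-a.e. classes of) measurable functions $f:\Omega\to\mathbb{R}$. A quasi-norm on a real vector space $X$ is a function $\|\cdot\|_X:X\to[0,\infty)$ with $\|x\|_X=0\iff x=0$, $\|\alpha x\|_X=|\alpha|\|x\|_X$, and, for some constant $K\ge 1$ (a quasi-triangle constant), $\|x_1+x_2\|_X\le K(\|x_1\|_X+\|x_2\|_X)$ for all $x_1,x_2$. A quasi-normed function space over $\mu$ is a linear subspace $X\subseteq L^0(\mu)$ with a quasi-norm such that (a) if $f\in L^0(\mu)$, $g\in X$ and $|f|\le|g|$ $\mu$-a.e., then $f\in X$ and $\|f\|_X\le\|g\|_X$; (b) $\chi_\Omega\in X$. A quasi-Banach function space is a complete quasi-normed function space. A Young function is a function $\Phi:[0,\infty)\to[0,\infty)$ that is strictly increasing, continuous, convex, with $\Phi(0)=0$ and $\lim_{t\to\infty}\Phi(t)=\infty$. Orlicz class: $\widetilde{X}^{\Phi}:=\{f\in L^0(\mu):\Phi(|f|)\in X\}$. Orlicz space: $X^{\Phi}:=\{f\in L^0(\mu): \exists\, c>0 \text{ with } |f|/c\in\widetilde{X}^{\Phi}\}$. Luxemburg quasi-norm: $\|f\|_{X^{\Phi}}:=\inf\{k>0: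 |f|/k\in\widetilde{X}^{\Phi}\text{ and }\|\Phi(|f|/k)\|_X\le 1\}$ for $f\in X^\Phi$. *)

theory Defs
  imports "HOL-Analysis.Analysis"
begin

text \<open>
  An element of \<open>L\<^sup>0(M)\<close> is represented by any of its representatives in
  \<open>borel_measurable M\<close>; equality in \<open>L\<^sup>0(M)\<close> is equality almost everywhere. A space of classes is
  a set \<open>X\<close> of representatives, and a functional on it is a function \<open>N\<close> on representatives.
  For the spaces below, the ideal property makes \<open>X\<close> and \<open>N\<close> compatible with equality
  almost everywhere; see \<open>qnfs_AE_cong\<close>.
\<close>

definition L0_subspace :: "'a measure \<Rightarrow> ('a \<Rightarrow> real) set \<Rightarrow> bool" where
  "L0_subspace M X \<longleftrightarrow>
     X \<subseteq> borel_measurable M \<and>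
     (\<lambda>x. 0) \<in> X \<and>
     (\<forall>f\<in>X. \<forall>g\<in>X. (\<lambda>x. f x + g x) \<in> X) \<and>
     (\<forall>c. \<forall>f\<in>X. (\<lambda>x. c * f x) \<in> X)"

definition quasi_norm_on :: "'a measure \<Rightarrow> ('a \<Rightarrow> real) set \<Rightarrow> (('a \<Rightarrow> real) \<Rightarrow> real) \<Rightarrow> bool" where
  "quasi_norm_on M X N \<longleftrightarrow>
     (\<forall>f\<in>X. 0 \<le> N f) \<and>
     (\<forall>f\<in>X. N f = 0 \<longleftrightarrow> (AE x in M. f x = 0)) \<and>
     (\<forall>c. \<forall>f\<in>X. N (\<lambda>x. c * f x) = \<bar>c\<bar> * N f) \<and>
     (\<exists>K\<ge>1. \<forall>f\<in>X. \<forall>g\<in>X. N (\<lambda>x. f x + g x) \<le> K * (N f + N g))"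

definition quasi_normed_function_space ::
    "'a measure \<Rightarrow> ('a \<Rightarrow> real) set \<Rightarrow> (('a \<Rightarrow> real) \<Rightarrow> real) \<Rightarrow> bool" where
  "quasi_normed_function_space M X N \<longleftrightarrow>
     L0_subspace M X \<and>
     quasi_norm_on M X N \<and>
     (\<forall>f\<in>borel_measurable M. \<forall>g\<in>X.
        (AE x in M. \<bar>f x\<bar> \<le> \<bar>g x\<bar>) \<longrightarrow> f \<in> X \<and> N f \<le> N g) \<and>
     indicator (space M) \<in> X"

lemma qnfs_AE_cong:
  assumes "quasi_normed_function_space M X N" "g \<in> X" "f \<in> borel_measurable M"
    and "AE x in M. f x = g x"
  shows "f \<in> X" "N f = N g"
proof -
  have ideal: "f \<in> X \<and> N f \<le> N g"
    if "f \<in> borel_measurable M" "g \<in> X" "AE x in M. \<bar>f x\<bar> \<le> \<bar>g x\<bar>" for f g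
    using assms(1) that unfolding quasi_normed_function_space_def by blast
  have "g \<in> borel_measurable M"
    using assms(1,2) unfolding quasi_normed_function_space_def L0_subspace_def by blast
  moreover have "AE x in M. \<bar>f x\<bar> \<le> \<bar>g x\<bar>" "AE x in M. \<bar>g x\<bar> \<le> \<bar>f x\<bar>"
    using assms(4) by (auto elim: eventually_mono)
  ultimately show "f \<in> X" "N f = N g"
    using ideal[of f g] ideal[of g f] assms(2,3) by auto
qed

definition quasi_norm_complete :: "('a \<Rightarrow> real) set \<Rightarrow> (('a \<Rightarrow> real) \<Rightarrow> real) \<Rightarrow> bool" where
  "quasi_norm_complete X N \<longleftrightarrow>
     (\<forall>u :: nat \<Rightarrow> 'a \<Rightarrow> real.
        (\<forall>n. u n \<in> X) \<and>
        (\<forall>e>0. \<exists>n0. \<forall>m\<ge>n0. \<forall>n\<ge>n0. N (\<lambda>x. u m x - u n x) < e) \<longrightarrow>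
        (\<exists>f\<in>X. (\<lambda>n. N (\<lambda>x. u n x - f x)) \<longlonglongrightarrow> 0))"

definition quasi_banach_function_space ::
    "'a measure \<Rightarrow> ('a \<Rightarrow> real) set \<Rightarrow> (('a \<Rightarrow> real) \<Rightarrow> real) \<Rightarrow> bool" where
  "quasi_banach_function_space M X N \<longleftrightarrow>
     quasi_normed_function_space M X N \<and> quasi_norm_complete X N"

text \<open>Only the values of \<open>\<Phi>\<close> on \<open>[0,\<infinity>)\<close> are relevant, here and in all definitions below.\<close>

definition young_function :: "(real \<Rightarrow> real) \<Rightarrow> bool" where
  "young_function \<Phi> \<longleftrightarrow>
     \<Phi> \<in> {0..} \<rightarrow> {0..} \<and>
     strict_mono_on {0..} \<Phi> \<and>
     continuous_on {0..} \<Phi> \<and>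
     convex_on {0..} \<Phi> \<and>
     \<Phi> 0 = 0 \<and>
     filterlim \<Phi> at_top at_top"

definition orlicz_class ::
    "'a measure \<Rightarrow> (real \<Rightarrow> real) \<Rightarrow> ('a \<Rightarrow> real) set \<Rightarrow> ('a \<Rightarrow> real) set" where
  "orlicz_class M \<Phi> X = {f \<in> borel_measurable M. (\<lambda>x. \<Phi> \<bar>f x\<bar>) \<in> X}"

definition orlicz_space ::
    "'a measure \<Rightarrow> (real \<Rightarrow> real) \<Rightarrow> ('a \<Rightarrow> real) set \<Rightarrow> ('a \<Rightarrow> real) set" where
  "orlicz_space M \<Phi> X =
     {f \<in> borel_measurable M. \<exists>c>0. (\<lambda>x. \<bar>f x\<bar> / c) \<in> orlicz_class M \<Phi> X}"

definition luxemburg_norm ::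
    "'a measure \<Rightarrow> (real \<Rightarrow> real) \<Rightarrow> ('a \<Rightarrow> real) set \<Rightarrow> (('a \<Rightarrow> real) \<Rightarrow> real) \<Rightarrow>
     ('a \<Rightarrow> real) \<Rightarrow> real" where
  "luxemburg_norm M \<Phi> X N f =
     Inf {k. 0 < k \<and> (\<lambda>x. \<bar>f x\<bar> / k) \<in> orlicz_class M \<Phi> X \<and> N (\<lambda>x. \<Phi> (\<bar>f x\<bar> / k)) \<le> 1}"

end

theory Submission
  imports Defs
begin

text \<open>
  Completeness rests on the Riesz--Fischer idea, and uses no Fatou property of \<open>X\<close>. From a Cauchy
  sequence in \<open>X\<^sup>\<Phi>\<close> extract a subsequence \<open>w\<close> whose increments satisfy
  \<open>\<parallel>w (i + 1) - w i\<parallel> < a\<^sub>i / 2\<^sup>i\<close> with \<open>a\<^sub>i = (2K)\<^sup>-\<^sup>i\<^sup>-\<^sup>1\<close>, and put \<open>h\<^sub>i = 2\<^sup>i \<bar>w (i + 1) - w i\<bar> / a\<^sub>i\<close>.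
  Since \<open>\<parallel>\<Phi>(h\<^sub>i)\<parallel>\<^sub>X \<le> 1\<close>, the series \<open>\<Sum> a\<^sub>i \<Phi>(h\<^sub>i)\<close> converges in \<open>X\<close> to some \<open>S\<close>, which bounds
  every partial sum a.e. because these increase. By convexity \<open>\<Phi>(\<Sum> 2\<^sup>i \<bar>w (i + 1) - w i\<bar>) \<le> S\<close> a.e.,
  so \<open>w\<close> converges a.e. to some \<open>f\<close> with \<open>\<Phi>(2\<^sup>m \<bar>f - w m\<bar>) \<le> S\<close> for all \<open>m\<close>; the same \<open>S\<close> serves
  for every \<open>m\<close>, whence \<open>\<parallel>f - w m\<parallel> \<le> max 1 \<parallel>S\<parallel>\<^sub>X / 2\<^sup>m\<close>.
\<close>

section \<open>Young functions\<close>

context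
  fixes \<Phi> :: "real \<Rightarrow> real"
  assumes young: "young_function \<Phi>"
begin

lemma young_zero: "\<Phi> 0 = 0"
  using young by (simp add: young_function_def)

lemma young_nonneg: "0 \<le> t \<Longrightarrow> 0 \<le> \<Phi> t"
  using young by (auto simp: young_function_def)

lemma young_mono: "0 \<le> s \<Longrightarrow> s \<le> t \<Longrightarrow> \<Phi> s \<le> \<Phi> t"
  using young strict_mono_on_leD[of "{0..}" \<Phi> s t] by (auto simp: young_function_def)

lemma young_pos: "0 < t \<Longrightarrow> 0 < \<Phi> t"
  using young strict_mono_onD[of "{0..}" \<Phi> 0 t] by (auto simp: young_function_def)

text \<open>The missing weight \<open>1 - a - b\<close> is placed at \<open>0\<close>, where
  \<open>\<Phi>\<close> vanishes. Convexity is applied between \<open>s\<close> and a rescaled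
  \<open>t\<close>, then between \<open>0\<close> and \<open>t\<close>.\<close>

lemma young_subconvex:
  assumes "0 \<le> a" "0 \<le> b" "a + b \<le> 1" "0 \<le> s" "0 \<le> t"
  shows "\<Phi> (a * s + b * t) \<le> a * \<Phi> s + b * \<Phi> t"
proof -
  have conv: "\<Phi> (u * x + v * y) \<le> u * \<Phi> x + v * \<Phi> y"
    if "0 \<le> u" "0 \<le> v" "u + v = 1" "0 \<le> x" "0 \<le> y" for u v x y
    using young that unfolding young_function_def convex_on_def by simp
  show ?thesis
  proof (cases "a = 0")
    case True
    then show ?thesis
      using conv[of "1 - b" b 0 t] assms young_zero by simp
  next
    case False
    \<comment> \<open>For \<open>a = 1\<close> the quotient is \<open>0\<close> by the convention
      for division by zero; then \<open>b = 0\<close> too, and both estimates below are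
      immediate.\<close>
    let ?y = "(b / (1 - a)) * t"
    have "\<Phi> (a * s + b * t) \<le> a * \<Phi> s + (1 - a) * \<Phi> ?y"
    proof (cases "a = 1")
      case True
      then have "b = 0" using assms by simp
      then show ?thesis using True by simp
    next
      case False
      then show ?thesis using conv[of a "1 - a" s ?y] assms by simp
    qed
    moreover have "(1 - a) * \<Phi> ?y \<le> b * \<Phi> t"
    proof (cases "a = 1")
      case True
      then show ?thesis using assms young_nonneg[of t] by simp
    next
      case False
      then have "b / (1 - a) \<le> 1" "0 \<le> b / (1 - a)"
        using assms by (auto simp: divide_simps)
      then have "\<Phi> ?y \<le> b / (1 - a) * \<Phi> t"
        using conv[of "1 - b / (1 - a)" "b / (1 - a)" 0 t] assms young_zero by simp
      then have "(1 - a) * \<Phi> ?y \<le> (1 - a) * (b / (1 - a) * \<Phi> t)"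
        using assms by (intro mult_left_mono) auto
      then show ?thesis using False by simp
    qed
    ultimately show ?thesis by simp
  qed
qed

lemma young_scale: "0 \<le> a \<Longrightarrow> a \<le> 1 \<Longrightarrow> 0 \<le> t \<Longrightarrow> \<Phi> (a * t) \<le> a * \<Phi> t"
  using young_subconvex[of a 0 t 0] by simp

text \<open>Horner's scheme: after splitting off the first term, a factor \<open>c\<close> comes out
  of the shifted tail, so each step is \<open>young_subconvex\<close> with the two weights
  \<open>c\<close> and \<open>c\<close>, whose sum is at most 1.\<close>

lemma young_geometric_sum:
  assumes "0 \<le> c" "c \<le> 1 / 2" "\<And>i. 0 \<le> h i"
  shows "\<Phi> (\<Sum>i<n. c ^ Suc i * h i) \<le> (\<Sum>i<n. c ^ Suc i * \<Phi> (h i))"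
  using assms(3)
proof (induction n arbitrary: h)
  case 0
  then show ?case by (simp add: young_zero)
next
  case (Suc n)
  let ?y = "\<Sum>i<n. c ^ Suc i * h (Suc i)"
  have "\<Phi> (\<Sum>i<Suc n. c ^ Suc i * h i) = \<Phi> (c * h 0 + c * ?y)"
    by (subst sum.lessThan_Suc_shift) (simp add: sum_distrib_left mult.assoc)
  also have "\<dots> \<le> c * \<Phi> (h 0) + c * \<Phi> ?y"
    using assms Suc.prems by (intro young_subconvex sum_nonneg) auto
  also have "\<dots> \<le> c * \<Phi> (h 0) + c * (\<Sum>i<n. c ^ Suc i * \<Phi> (h (Suc i)))"
    using Suc assms by (intro add_left_mono mult_left_mono) auto
  also have "\<dots> = (\<Sum>i<Suc n. c ^ Suc i * \<Phi> (h i))"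
    by (subst sum.lessThan_Suc_shift) (simp add: sum_distrib_left mult.assoc)
  finally show ?case .
qed

text \<open>Only the values of \<open>\<Phi>\<close> on the half-line are controlled; composing with
  the absolute value gives a function continuous on the whole line, as Borel measurability and
  limits require.\<close>

lemma young_abs_continuous: "continuous_on UNIV (\<lambda>t. \<Phi> \<bar>t\<bar>)"
proof -
  have "continuous_on {0..} \<Phi>"
    using young by (simp add: young_function_def)
  then show ?thesis
    by (rule continuous_on_compose2) (auto intro!: continuous_intros)
qed

lemma young_abs_measurable:
  "f \<in> borel_measurable M \<Longrightarrow> (\<lambda>x. \<Phi> \<bar>f x\<bar>) \<in> borel_measurable M"
  by (rule borel_measurable_continuous_on[OF young_abs_continuous])

lemma young_abs_divide_measurable:
  assumes "f \<in> borel_measurable M" "0 < k"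
  shows "(\<lambda>x. \<Phi> (\<bar>f x\<bar> / k)) \<in> borel_measurable M"
proof -
  have "(\<lambda>x. \<Phi> \<bar>f x / k\<bar>) \<in> borel_measurable M"
    using assms by (intro young_abs_measurable) auto
  then show ?thesis using assms by simp
qed

text \<open>Growth at infinity turns a bound on \<open>\<Phi>\<close> of a weighted variation into a
  bound on the variation itself.\<close>

lemma young_bounded_imp:
  obtains R where "0 < R" "\<And>t. 0 \<le> t \<Longrightarrow> \<Phi> t \<le> s \<Longrightarrow> t \<le> R"
proof -
  have "filterlim \<Phi> at_top at_top"
    using young by (simp add: young_function_def)
  then have "eventually (\<lambda>t. s < \<Phi> t) at_top"
    by (simp add: filterlim_at_top_dense)
  then obtain R where "\<And>t. R \<le> t \<Longrightarrow> s < \<Phi> t"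
    by (auto simp: eventually_at_top_linorder)
  then have "\<And>t. \<Phi> t \<le> s \<Longrightarrow> t \<le> max 1 R"
    by (smt (verit))
  then show ?thesis by (intro that[of "max 1 R"]) auto
qed

text \<open>The weighted variation is bounded and dominates
  \<open>2 ^ m * \<bar>w n - w m\<bar>\<close> for \<open>n \<ge> m\<close>. Hence \<open>w\<close>
  is Cauchy with geometric rate, and the bound passes to the limit by continuity of
  \<open>\<Phi>\<close>.\<close>

lemma young_weighted_increments_limit:
  fixes w :: "nat \<Rightarrow> real"
  assumes bound: "\<And>n. \<Phi> (\<Sum>i<n. 2 ^ i * \<bar>w (Suc i) - w i\<bar>) \<le> s"
  shows "\<Phi> (2 ^ m * \<bar>lim w - w m\<bar>) \<le> s"
proof -
  let ?G = "\<lambda>n. \<Sum>i<n. 2 ^ i * \<bar>w (Suc i) - w i\<bar>"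
  have tail: "2 ^ m * \<bar>w n - w m\<bar> \<le> ?G n" if "m \<le> n" for m n
  proof -
    have "2 ^ m * \<bar>w n - w m\<bar> = 2 ^ m * \<bar>\<Sum>i\<in>{m..<n}. w (Suc i) - w i\<bar>"
      using that by (simp add: sum_Suc_diff')
    also have "\<dots> \<le> 2 ^ m * (\<Sum>i\<in>{m..<n}. \<bar>w (Suc i) - w i\<bar>)"
      by (intro mult_left_mono sum_abs) auto
    also have "\<dots> = (\<Sum>i\<in>{m..<n}. 2 ^ m * \<bar>w (Suc i) - w i\<bar>)"
      by (simp add: sum_distrib_left)
    \<comment> \<open>Every index here is at least \<open>m\<close>, so the weight
      \<open>2 ^ m\<close> may be raised to \<open>2 ^ i\<close>.\<close>
    also have "\<dots> \<le> (\<Sum>i\<in>{m..<n}. 2 ^ i * \<bar>w (Suc i) - w i\<bar>)"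
      by (intro sum_mono mult_right_mono power_increasing) auto
    also have "\<dots> \<le> ?G n"
      by (intro sum_mono2) auto
    finally show ?thesis .
  qed
  obtain R where R: "0 < R" "\<And>t. 0 \<le> t \<Longrightarrow> \<Phi> t \<le> s \<Longrightarrow> t \<le> R"
    by (rule young_bounded_imp[where s = s]) blast
  have GR: "?G n \<le> R" for n
    by (intro R(2) bound sum_nonneg) auto
  have dist_bound: "\<bar>w n - w m\<bar> \<le> R * (1 / 2) ^ m" if "m \<le> n" for m n
    using order_trans[OF tail[OF that] GR] by (simp add: field_simps power_divide)
  have "Cauchy w"
  proof (rule metric_CauchyI)
    fix e :: real assume "0 < e"
    have "(\<lambda>m. R * (1 / 2) ^ m) \<longlonglongrightarrow> R * 0"
      by (intro tendsto_intros LIMSEQ_power_zero) auto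
    then have "eventually (\<lambda>m. R * (1 / 2) ^ m < e) sequentially"
      using \<open>0 < e\<close> by (intro order_tendstoD(2)[of _ 0]) auto
    then obtain n0 where n0: "\<And>m. n0 \<le> m \<Longrightarrow> R * (1 / 2) ^ m < e"
      by (auto simp: eventually_sequentially)
    show "\<exists>M. \<forall>m\<ge>M. \<forall>n\<ge>M. dist (w m) (w n) < e"
    proof (intro exI[of _ n0] allI impI)
      fix m n assume "n0 \<le> m" "n0 \<le> n"
      then show "dist (w m) (w n) < e"
        using dist_bound[of m n] dist_bound[of n m] n0[of m] n0[of n] linear[of m n]
        by (auto simp: dist_real_def abs_minus_commute)
    qed
  qed
  then have "w \<longlonglongrightarrow> lim w"
    by (simp add: Cauchy_convergent convergent_LIMSEQ_iff[symmetric])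
  then have "(\<lambda>n. 2 ^ m * (w n - w m)) \<longlonglongrightarrow> 2 ^ m * (lim w - w m)"
    by (intro tendsto_intros)
  then have "(\<lambda>n. \<Phi> \<bar>2 ^ m * (w n - w m)\<bar>) \<longlonglongrightarrow> \<Phi> \<bar>2 ^ m * (lim w - w m)\<bar>"
    using young_abs_continuous
    by (intro isCont_tendsto_compose[where g = "\<lambda>t. \<Phi> \<bar>t\<bar>"])
      (auto simp: continuous_on_eq_continuous_at)
  then have "\<Phi> \<bar>2 ^ m * (lim w - w m)\<bar> \<le> s"
  proof (rule LIMSEQ_le_const2)
    have "\<Phi> \<bar>2 ^ m * (w n - w m)\<bar> \<le> s" if "m \<le> n" for n
      using young_mono[OF _ tail[OF that]] bound[of n] by (simp add: abs_mult)
    then show "\<exists>n0. \<forall>n\<ge>n0. \<Phi> \<bar>2 ^ m * (w n - w m)\<bar> \<le> s" by blast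
  qed
  then show ?thesis by (simp add: abs_mult)
qed

end

section \<open>Quasi-normed function spaces\<close>

text \<open>One quasi-triangle constant is fixed as a parameter, because the weights of the series
  built below depend on it.\<close>

locale qnfs =
  fixes M :: "'a measure" and X :: "('a \<Rightarrow> real) set" and N :: "('a \<Rightarrow> real) \<Rightarrow> real"
    and K :: real
  assumes space: "quasi_normed_function_space M X N"
    and K_ge_1: "1 \<le> K"
    and quasi_triangle: "\<And>f g. f \<in> X \<Longrightarrow> g \<in> X \<Longrightarrow> N (\<lambda>x. f x + g x) \<le> K * (N f + N g)"
begin

lemma measurable: "f \<in> X \<Longrightarrow> f \<in> borel_measurable M"
  and zero_mem: "(\<lambda>x. 0) \<in> X"
  and add_mem: "f \<in> X \<Longrightarrow> g \<in> X \<Longrightarrow> (\<lambda>x. f x + g x) \<in> X"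
  and scale_mem: "f \<in> X \<Longrightarrow> (\<lambda>x. c * f x) \<in> X"
  and indicator_mem: "indicator (space M) \<in> X"
  using space unfolding quasi_normed_function_space_def L0_subspace_def by auto

lemma norm_nonneg: "f \<in> X \<Longrightarrow> 0 \<le> N f"
  and norm_eq_0_iff: "f \<in> X \<Longrightarrow> N f = 0 \<longleftrightarrow> (AE x in M. f x = 0)"
  and norm_scale: "f \<in> X \<Longrightarrow> N (\<lambda>x. c * f x) = \<bar>c\<bar> * N f"
  using space unfolding quasi_normed_function_space_def quasi_norm_on_def by auto

lemma ideal:
  assumes "f \<in> borel_measurable M" "g \<in> X" "AE x in M. \<bar>f x\<bar> \<le> \<bar>g x\<bar>"
  shows "f \<in> X" "N f \<le> N g"
  using space assms unfolding quasi_normed_function_space_def by blast+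

lemma diff_mem: "f \<in> X \<Longrightarrow> g \<in> X \<Longrightarrow> (\<lambda>x. f x - g x) \<in> X"
  using add_mem[of f "\<lambda>x. -1 * g x"] scale_mem[of g "-1"] by simp

lemma norm_diff_commute:
  assumes "f \<in> X" "g \<in> X"
  shows "N (\<lambda>x. f x - g x) = N (\<lambda>x. g x - f x)"
  using norm_scale[OF diff_mem[OF assms], of "-1"] by simp

lemma norm_diff_triangle:
  assumes "f \<in> X" "g \<in> X" "h \<in> X"
  shows "N (\<lambda>x. f x - h x) \<le> K * (N (\<lambda>x. f x - g x) + N (\<lambda>x. g x - h x))"
  using quasi_triangle[OF diff_mem[OF assms(1,2)] diff_mem[OF assms(2,3)]] by simp

section \<open>Sums, dominated series and limits of subsequences\<close>

lemma sum_mem: "(\<And>i. z i \<in> X) \<Longrightarrow> (\<lambda>x. \<Sum>i<(n::nat). z i x) \<in> X"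
  by (induction n) (auto simp: zero_mem intro: add_mem)

text \<open>Splitting off the first term costs one factor \<open>K\<close> each time. The constant
  at index \<open>i\<close> therefore depends on \<open>i\<close> but not on \<open>n\<close>, so
  geometric weights can compensate it.\<close>

lemma norm_sum_le:
  assumes "\<And>i. z i \<in> X"
  shows "N (\<lambda>x. \<Sum>i<n. z i x) \<le> (\<Sum>i<n. K ^ Suc i * N (z i))"
  using assms
proof (induction n arbitrary: z)
  case 0
  then show ?case using norm_scale[OF zero_mem, of 0] by simp
next
  case (Suc n)
  have "N (\<lambda>x. \<Sum>i<Suc n. z i x) = N (\<lambda>x. z 0 x + (\<Sum>i<n. z (Suc i) x))"
    by (simp only: sum.lessThan_Suc_shift)
  also have "\<dots> \<le> K * (N (z 0) + N (\<lambda>x. \<Sum>i<n. z (Suc i) x))"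
    using Suc.prems by (intro quasi_triangle sum_mem) auto
  also have "\<dots> \<le> K * (N (z 0) + (\<Sum>i<n. K ^ Suc i * N (z (Suc i))))"
    using Suc K_ge_1 by (intro mult_left_mono add_left_mono) auto
  also have "\<dots> = (\<Sum>i<Suc n. K ^ Suc i * N (z i))"
    by (subst sum.lessThan_Suc_shift) (simp add: sum_distrib_left algebra_simps)
  finally show ?case .
qed

text \<open>For \<open>m \<le> n\<close> one has \<open>(T m - S)\<^sup>+ \<le> \<bar>T n - S\<bar>\<close>, so the positive part has quasi-norm zero.\<close>

lemma incseq_le_limit:
  assumes T: "\<And>n. T n \<in> X" and S: "S \<in> X"
    and mono: "\<And>m n x. m \<le> n \<Longrightarrow> x \<in> space M \<Longrightarrow> T m x \<le> T n x"
    and lim: "(\<lambda>n. N (\<lambda>x. T n x - S x)) \<longlonglongrightarrow> 0"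
  shows "AE x in M. T m x \<le> S x"
proof -
  let ?p = "\<lambda>x. max 0 (T m x - S x)"
  have meas: "?p \<in> borel_measurable M"
    using measurable[OF T[of m]] measurable[OF S] by measurable
  have le: "?p \<in> X" "N ?p \<le> N (\<lambda>x. T n x - S x)" if "m \<le> n" for n
  proof -
    have "AE x in M. \<bar>?p x\<bar> \<le> \<bar>T n x - S x\<bar>"
    proof (rule AE_I2)
      fix x assume "x \<in> space M"
      then show "\<bar>?p x\<bar> \<le> \<bar>T n x - S x\<bar>"
        using mono[OF that, of x] by auto
    qed
    then show "?p \<in> X" "N ?p \<le> N (\<lambda>x. T n x - S x)"
      using ideal[OF meas diff_mem[OF T S]] by auto
  qed
  have "N ?p \<le> 0"
    using le(2) by (intro LIMSEQ_le_const[OF lim]) auto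
  then have "N ?p = 0"
    using norm_nonneg[OF le(1)[of m]] by simp
  then have "AE x in M. ?p x = 0"
    using norm_eq_0_iff[OF le(1)[of m]] by simp
  then show ?thesis
    by (rule eventually_mono) (simp add: max_def split: if_splits)
qed

text \<open>The weights cancel the powers of \<open>K\<close> from \<open>norm_sum_le\<close> and
  leave powers of 1/2, so the partial sums are Cauchy. They increase pointwise, and
  \<open>incseq_le_limit\<close> makes their limit an upper bound.\<close>

lemma geometric_series_dominated:
  assumes complete: "quasi_norm_complete X N"
    and v: "\<And>i. v i \<in> X" "\<And>i. N (v i) \<le> 1" "\<And>i x. 0 \<le> v i x"
  obtains S where "S \<in> X"
    "\<And>n. AE x in M. (\<Sum>i<n. (1 / (2 * K)) ^ Suc i * v i x) \<le> S x"
proof -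
  define z where "z i x = (1 / (2 * K)) ^ Suc i * v i x" for i x
  let ?T = "\<lambda>n x. \<Sum>i<n. z i x"
  have z: "z i \<in> X" for i
    unfolding z_def using v(1) by (intro scale_mem)
  have N_z: "N (z i) \<le> (1 / (2 * K)) ^ Suc i" for i
  proof -
    have "N (z i) = (1 / (2 * K)) ^ Suc i * N (v i)"
      unfolding z_def using norm_scale[OF v(1)] K_ge_1 by (simp del: power_Suc)
    also have "\<dots> \<le> (1 / (2 * K)) ^ Suc i * 1"
      using K_ge_1 v(2) by (intro mult_left_mono) auto
    finally show ?thesis by simp
  qed
  have T: "?T n \<in> X" for n
    by (intro sum_mem z)
  have increment: "N (\<lambda>x. ?T (m + j) x - ?T m x) \<le> (1 / 2) ^ m" for m j
  proof -
    have "(\<lambda>x. ?T (m + j) x - ?T m x) = (\<lambda>x. \<Sum>i<j. z (m + i) x)"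
      by (intro ext) (induction j, auto)
    then have "N (\<lambda>x. ?T (m + j) x - ?T m x) \<le> (\<Sum>i<j. K ^ Suc i * N (z (m + i)))"
      using norm_sum_le[of "\<lambda>i. z (m + i)"] z by simp
    also have "\<dots> \<le> (\<Sum>i<j. (1 / 2) ^ m * (1 / 2) ^ Suc i)"
    proof (rule sum_mono)
      fix i
      have "K ^ Suc i * N (z (m + i)) \<le> K ^ Suc i * (1 / (2 * K)) ^ Suc (m + i)"
        using K_ge_1 N_z by (intro mult_left_mono) auto
      \<comment> \<open>The tail is reindexed to start at \<open>0\<close>, so only
        \<open>Suc i\<close> of the \<open>Suc (m + i)\<close> factors \<open>1 / K\<close> are
        cancelled; the remaining \<open>m\<close> are at most 1.\<close>
      also have "\<dots> = (1 / K) ^ m * ((1 / 2) ^ m * (1 / 2) ^ Suc i)"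
        using K_ge_1 by (simp add: power_add power_divide power_mult_distrib field_simps)
      also have "\<dots> \<le> 1 * ((1 / 2) ^ m * (1 / 2) ^ Suc i)"
        using K_ge_1 by (intro mult_right_mono power_le_one) auto
      finally show "K ^ Suc i * N (z (m + i)) \<le> (1 / 2) ^ m * (1 / 2) ^ Suc i" by simp
    qed
    also have "\<dots> = (1 / 2) ^ m * (1 - (1 / 2) ^ j)"
    proof -
      have "(\<Sum>i<j. (1 / 2 :: real) ^ Suc i) = 1 - (1 / 2) ^ j"
        by (induction j) auto
      then show ?thesis by (simp only: sum_distrib_left[symmetric])
    qed
    also have "\<dots> \<le> (1 / 2) ^ m"
      by (simp add: mult_le_cancel_left1)
    finally show ?thesis .
  qed
  have "\<exists>n0. \<forall>m\<ge>n0. \<forall>n\<ge>n0. N (\<lambda>x. ?T m x - ?T n x) < e" if e: "0 < e" for e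
  proof -
    obtain n0 where n0: "(1 / 2) ^ n0 < e"
      using real_arch_pow_inv[OF e, of "1 / 2"] by auto
    have ordered: "N (\<lambda>x. ?T m x - ?T n x) < e" if "n0 \<le> n" "n \<le> m" for m n
    proof -
      have "N (\<lambda>x. ?T m x - ?T n x) \<le> (1 / 2) ^ n"
        using increment[of n "m - n"] that by simp
      also have "\<dots> \<le> (1 / 2) ^ n0"
        using that by (intro power_decreasing) auto
      finally show ?thesis using n0 by simp
    qed
    have "N (\<lambda>x. ?T m x - ?T n x) < e" if "n0 \<le> m" "n0 \<le> n" for m n
    proof (cases "n \<le> m")
      case True
      then show ?thesis using ordered that by blast
    next
      case False
      then show ?thesis
        using ordered[of m n] norm_diff_commute[OF T[of m] T[of n]] that by simp
    qed
    then show ?thesis by blast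
  qed
  then obtain S where S: "S \<in> X" "(\<lambda>n. N (\<lambda>x. ?T n x - S x)) \<longlonglongrightarrow> 0"
    using complete[unfolded quasi_norm_complete_def, rule_format, of ?T] T by blast
  have "?T m x \<le> ?T n x" if "m \<le> n" for m n x
    using that v(3) K_ge_1 by (intro sum_mono2) (auto simp: z_def)
  then have "AE x in M. ?T n x \<le> S x" for n
    using incseq_le_limit[of ?T S n] T S by blast
  then show ?thesis
    using that[OF S(1)] by (simp add: z_def)
qed

lemma Cauchy_subseq_limit:
  assumes u: "\<And>n. u n \<in> X" and f: "f \<in> X" and r: "strict_mono r"
    and Cauchy: "\<And>e. 0 < e \<Longrightarrow> \<exists>n0. \<forall>m\<ge>n0. \<forall>n\<ge>n0. N (\<lambda>x. u m x - u n x) < e"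
    and lim: "(\<lambda>m. N (\<lambda>x. u (r m) x - f x)) \<longlonglongrightarrow> 0"
  shows "(\<lambda>n. N (\<lambda>x. u n x - f x)) \<longlonglongrightarrow> 0"
proof (rule LIMSEQ_I)
  fix e :: real assume "0 < e"
  \<comment> \<open>The extra \<open>K\<close> absorbs the quasi-triangle constant when the two
    estimates are added.\<close>
  then have e': "0 < e / (2 * K)" using K_ge_1 by simp
  obtain n0 where n0: "\<And>m n. n0 \<le> m \<Longrightarrow> n0 \<le> n \<Longrightarrow> N (\<lambda>x. u m x - u n x) < e / (2 * K)"
    using Cauchy[OF e'] by blast
  have "eventually (\<lambda>m. N (\<lambda>x. u (r m) x - f x) < e / (2 * K)) sequentially"
    using order_tendstoD(2)[OF lim e'] .
  then have "eventually (\<lambda>m. N (\<lambda>x. u (r m) x - f x) < e / (2 * K) \<and> n0 \<le> m) sequentially"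
    using eventually_ge_at_top by (rule eventually_conj)
  then obtain m where m: "N (\<lambda>x. u (r m) x - f x) < e / (2 * K)" "n0 \<le> m"
    by (auto simp: eventually_sequentially)
  then have "n0 \<le> r m"
    using strict_mono_imp_increasing[OF r, of m] by simp
  have "norm (N (\<lambda>x. u n x - f x) - 0) < e" if "n0 \<le> n" for n
  proof -
    have "N (\<lambda>x. u n x - f x) \<le> K * (N (\<lambda>x. u n x - u (r m) x) + N (\<lambda>x. u (r m) x - f x))"
      by (intro norm_diff_triangle u f)
    also have "\<dots> < K * (e / (2 * K) + e / (2 * K))"
      using K_ge_1 n0[OF that \<open>n0 \<le> r m\<close>] m(1) by (intro mult_strict_left_mono) auto
    also have "\<dots> = e"
      using K_ge_1 by (simp add: field_simps)
    finally show ?thesis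
      using norm_nonneg[OF diff_mem[OF u f]] by simp
  qed
  then show "\<exists>n0. \<forall>n\<ge>n0. norm (N (\<lambda>x. u n x - f x) - 0) < e" by blast
qed

end

section \<open>The Luxemburg quasi-norm\<close>

locale orlicz = qnfs +
  fixes \<Phi> :: "real \<Rightarrow> real"
  assumes young: "young_function \<Phi>"
begin

abbreviation XPhi :: "('a \<Rightarrow> real) set"
  where "XPhi \<equiv> orlicz_space M \<Phi> X"

abbreviation lux :: "('a \<Rightarrow> real) \<Rightarrow> real"
  where "lux \<equiv> luxemburg_norm M \<Phi> X N"

text \<open>The set behind the Luxemburg infimum, with membership in the Orlicz class reduced to
  membership in \<open>X\<close>; measurability of \<open>f\<close> is carried separately (see
  \<open>lux_eq\<close>).\<close>

definition admissible :: "('a \<Rightarrow> real) \<Rightarrow> real set" where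
  "admissible f =
     {k. 0 < k \<and> (\<lambda>x. \<Phi> (\<bar>f x\<bar> / k)) \<in> X \<and> N (\<lambda>x. \<Phi> (\<bar>f x\<bar> / k)) \<le> 1}"

lemma orlicz_spaceD: "f \<in> XPhi \<Longrightarrow> f \<in> borel_measurable M"
  by (simp add: orlicz_space_def)

lemma orlicz_class_iff:
  assumes "f \<in> borel_measurable M" "0 < k"
  shows "(\<lambda>x. \<bar>f x\<bar> / k) \<in> orlicz_class M \<Phi> X \<longleftrightarrow> (\<lambda>x. \<Phi> (\<bar>f x\<bar> / k)) \<in> X"
  using assms by (auto simp: orlicz_class_def)

lemma lux_eq: "f \<in> borel_measurable M \<Longrightarrow> lux f = Inf (admissible f)"
  unfolding luxemburg_norm_def admissible_def
  by (intro arg_cong[where f = Inf]) (auto simp: orlicz_class_iff)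

lemma bdd_below_admissible: "bdd_below (admissible f)"
  by (intro bdd_belowI[of _ 0]) (auto simp: admissible_def)

text \<open>\<open>\<Phi> (\<bar>f\<bar> / k) \<le> \<Phi> (\<bar>g\<bar> / c) / max 1 b\<close> by convexity, where \<open>b\<close> bounds the quasi-norm.\<close>

lemma admissible_dominated:
  assumes f: "f \<in> borel_measurable M" and c: "0 < c" and G: "G \<in> X"
    and le: "AE x in M. \<Phi> (\<bar>f x\<bar> / c) \<le> G x"
    and b: "1 \<le> b" "N G \<le> b"
  shows "c * b \<in> admissible f"
proof -
  have "AE x in M. \<bar>\<Phi> (\<bar>f x\<bar> / (c * b))\<bar> \<le> \<bar>(1 / b) * G x\<bar>"
    using le
  proof (rule eventually_mono)
    fix x assume G_x: "\<Phi> (\<bar>f x\<bar> / c) \<le> G x"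
    have "\<Phi> (\<bar>f x\<bar> / (c * b)) = \<Phi> ((1 / b) * (\<bar>f x\<bar> / c))"
      by (simp add: field_simps)
    also have "\<dots> \<le> (1 / b) * \<Phi> (\<bar>f x\<bar> / c)"
      using b c by (intro young_scale[OF young]) auto
    also have "\<dots> \<le> (1 / b) * G x"
      using b G_x by (intro mult_left_mono) auto
    also have "\<dots> \<le> \<bar>(1 / b) * G x\<bar>"
      by (rule abs_ge_self)
    finally show "\<bar>\<Phi> (\<bar>f x\<bar> / (c * b))\<bar> \<le> \<bar>(1 / b) * G x\<bar>"
      using young_nonneg[OF young, of "\<bar>f x\<bar> / (c * b)"] b c by simp
  qed
  moreover have "(\<lambda>x. \<Phi> (\<bar>f x\<bar> / (c * b))) \<in> borel_measurable M"
    using b c by (intro young_abs_divide_measurable[OF young] f) auto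
  ultimately have "(\<lambda>x. \<Phi> (\<bar>f x\<bar> / (c * b))) \<in> X"
    "N (\<lambda>x. \<Phi> (\<bar>f x\<bar> / (c * b))) \<le> N (\<lambda>x. (1 / b) * G x)"
    using ideal[OF _ scale_mem[OF G, of "1 / b"]] by blast+
  moreover have "N (\<lambda>x. (1 / b) * G x) \<le> 1"
    using norm_scale[OF G, of "1 / b"] b by simp
  ultimately show ?thesis
    using b c by (simp add: admissible_def)
qed

lemma admissible_mono:
  assumes f: "f \<in> borel_measurable M" and k: "k \<in> admissible g"
    and le: "AE x in M. \<bar>f x\<bar> \<le> \<bar>g x\<bar>" and "k \<le> l"
  shows "l \<in> admissible f"
proof -
  have pos: "0 < k" "0 < l" using k \<open>k \<le> l\<close> by (auto simp: admissible_def)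
  have "AE x in M. \<Phi> (\<bar>f x\<bar> / l) \<le> \<Phi> (\<bar>g x\<bar> / k)"
    using le
  proof (rule eventually_mono)
    fix x assume "\<bar>f x\<bar> \<le> \<bar>g x\<bar>"
    then have "\<bar>f x\<bar> / l \<le> \<bar>g x\<bar> / k"
      using pos \<open>k \<le> l\<close> by (intro frac_le) auto
    then show "\<Phi> (\<bar>f x\<bar> / l) \<le> \<Phi> (\<bar>g x\<bar> / k)"
      using pos by (intro young_mono[OF young]) auto
  qed
  then show ?thesis
    using admissible_dominated[OF f pos(2), of "\<lambda>x. \<Phi> (\<bar>g x\<bar> / k)" 1] k
    by (simp add: admissible_def)
qed

text \<open>Enlarging \<open>c\<close> by the factor \<open>max 1 (N ...)\<close> brings the
  quasi-norm down to at most 1. Thus on \<open>XPhi\<close> the Luxemburg infimum is never taken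
  over the empty set.\<close>

lemma orlicz_space_iff: "f \<in> XPhi \<longleftrightarrow> f \<in> borel_measurable M \<and> admissible f \<noteq> {}"
proof
  assume "f \<in> XPhi"
  then obtain c where f: "f \<in> borel_measurable M" and c: "0 < c"
    and X: "(\<lambda>x. \<Phi> (\<bar>f x\<bar> / c)) \<in> X"
    by (auto simp: orlicz_space_def orlicz_class_iff)
  have "c * max 1 (N (\<lambda>x. \<Phi> (\<bar>f x\<bar> / c))) \<in> admissible f"
    by (rule admissible_dominated[OF f c X]) auto
  with f show "f \<in> borel_measurable M \<and> admissible f \<noteq> {}" by blast
next
  assume "f \<in> borel_measurable M \<and> admissible f \<noteq> {}"
  then show "f \<in> XPhi"
    by (auto simp: orlicz_space_def admissible_def orlicz_class_iff)
qed

lemma orlicz_spaceI: "f \<in> borel_measurable M \<Longrightarrow> k \<in> admissible f \<Longrightarrow> f \<in> XPhi"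
  by (auto simp: orlicz_space_iff)

lemma lux_le: "f \<in> borel_measurable M \<Longrightarrow> k \<in> admissible f \<Longrightarrow> lux f \<le> k"
  by (simp add: lux_eq cInf_lower bdd_below_admissible)

lemma lux_nonneg: "f \<in> XPhi \<Longrightarrow> 0 \<le> lux f"
  by (auto simp: orlicz_space_iff lux_eq admissible_def intro!: cInf_greatest)

text \<open>Some admissible constant lies below \<open>k\<close>, and \<open>admissible f\<close> is
  upward closed. The strict inequality avoids any appeal to attainment of the infimum.\<close>

lemma lux_less_admissible:
  assumes f: "f \<in> XPhi" and "lux f < k"
  shows "k \<in> admissible f"
proof -
  have meas: "f \<in> borel_measurable M" and "admissible f \<noteq> {}"
    using f by (auto simp: orlicz_space_iff)
  then obtain j where "j \<in> admissible f" "j < k"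
    using assms(2) bdd_below_admissible[of f] by (auto simp: lux_eq cInf_less_iff)
  then show ?thesis
    using admissible_mono[OF meas, of j f k] by simp
qed

lemma lux_le_scaled:
  assumes f: "f \<in> borel_measurable M" and g: "g \<in> XPhi" and "0 \<le> C"
    and scaled: "\<And>k. k \<in> admissible g \<Longrightarrow> C * k \<in> admissible f"
  shows "lux f \<le> C * lux g"
proof (rule field_le_epsilon)
  fix e :: real assume "0 < e"
  \<comment> \<open>The denominator \<open>C + 1\<close> also covers \<open>C = 0\<close>, and
    \<open>C / (C + 1) \<le> 1\<close> leaves an error of at most \<open>e\<close>.\<close>
  have "lux g < lux g + e / (C + 1)"
    using \<open>0 < e\<close> \<open>0 \<le> C\<close> by simp
  then have "lux f \<le> C * (lux g + e / (C + 1))"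
    by (intro lux_le[OF f] scaled lux_less_admissible[OF g])
  also have "\<dots> \<le> C * lux g + e"
    using \<open>0 < e\<close> \<open>0 \<le> C\<close> by (simp add: field_simps)
  finally show "lux f \<le> C * lux g + e" .
qed

section \<open>Ideal property and quasi-norm axioms of the Orlicz space\<close>

lemma orlicz_ideal:
  assumes f: "f \<in> borel_measurable M" and g: "g \<in> XPhi"
    and le: "AE x in M. \<bar>f x\<bar> \<le> \<bar>g x\<bar>"
  shows "f \<in> XPhi" "lux f \<le> lux g"
proof -
  have adm: "k \<in> admissible f" if "k \<in> admissible g" for k
    using admissible_mono[OF f that le] by simp
  show "f \<in> XPhi"
    using adm f g by (auto simp: orlicz_space_iff)
  show "lux f \<le> lux g"
    using lux_le_scaled[OF f g, of 1] adm by simp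
qed

text \<open>Convexity with weights \<open>a / (a + b)\<close> and \<open>b / (a + b)\<close>
  dominates \<open>\<Phi> (\<bar>f + g\<bar> / (a + b))\<close> by a function of quasi-norm at most
  \<open>K\<close>; \<open>admissible_dominated\<close> turns this bound into the factor
  \<open>K\<close>. So the Orlicz space inherits the same constant.\<close>

lemma admissible_add:
  assumes f: "f \<in> borel_measurable M" and g: "g \<in> borel_measurable M"
    and a: "a \<in> admissible f" and b: "b \<in> admissible g"
  shows "K * (a + b) \<in> admissible (\<lambda>x. f x + g x)"
proof -
  have pos: "0 < a" "0 < b" using a b by (auto simp: admissible_def)
  define s where "s = a / (a + b)"
  define t where "t = b / (a + b)"
  have st: "0 \<le> s" "0 \<le> t" "s + t = 1"
    using pos by (auto simp: s_def t_def add_divide_distrib[symmetric])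
  let ?F = "\<lambda>x. \<Phi> (\<bar>f x\<bar> / a)" and ?G = "\<lambda>x. \<Phi> (\<bar>g x\<bar> / b)"
  have F: "?F \<in> X" "N ?F \<le> 1" and G: "?G \<in> X" "N ?G \<le> 1"
    using a b by (auto simp: admissible_def)
  have "\<Phi> (\<bar>f x + g x\<bar> / (a + b)) \<le> s * ?F x + t * ?G x" for x
  proof -
    have "\<bar>f x + g x\<bar> / (a + b) \<le> (\<bar>f x\<bar> + \<bar>g x\<bar>) / (a + b)"
      using pos by (intro divide_right_mono) auto
    also have "\<dots> = s * (\<bar>f x\<bar> / a) + t * (\<bar>g x\<bar> / b)"
      using pos by (simp add: s_def t_def add_divide_distrib)
    finally have "\<Phi> (\<bar>f x + g x\<bar> / (a + b)) \<le> \<Phi> (s * (\<bar>f x\<bar> / a) + t * (\<bar>g x\<bar> / b))"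
      using pos by (intro young_mono[OF young]) auto
    also have "\<dots> \<le> s * ?F x + t * ?G x"
      using st pos by (intro young_subconvex[OF young]) auto
    finally show ?thesis .
  qed
  moreover have "N (\<lambda>x. s * ?F x + t * ?G x) \<le> K"
  proof -
    have "N (\<lambda>x. s * ?F x + t * ?G x) \<le> K * (N (\<lambda>x. s * ?F x) + N (\<lambda>x. t * ?G x))"
      by (intro quasi_triangle scale_mem F G)
    also have "\<dots> = K * (s * N ?F + t * N ?G)"
      using norm_scale[OF F(1)] norm_scale[OF G(1)] st by simp
    also have "\<dots> \<le> K * (s * 1 + t * 1)"
      using st F G K_ge_1 by (intro mult_left_mono add_mono) auto
    finally show ?thesis using st by simp
  qed
  ultimately have "(a + b) * K \<in> admissible (\<lambda>x. f x + g x)"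
    using pos f g K_ge_1
    by (intro admissible_dominated[where G = "\<lambda>x. s * ?F x + t * ?G x"]
          add_mem scale_mem F G) auto
  then show ?thesis by (simp add: mult.commute)
qed

lemma orlicz_add_mem: "f \<in> XPhi \<Longrightarrow> g \<in> XPhi \<Longrightarrow> (\<lambda>x. f x + g x) \<in> XPhi"
  unfolding orlicz_space_iff using admissible_add by fastforce

lemma lux_triangle:
  assumes f: "f \<in> XPhi" and g: "g \<in> XPhi"
  shows "lux (\<lambda>x. f x + g x) \<le> K * (lux f + lux g)"
proof (rule field_le_epsilon)
  fix e :: real assume "0 < e"
  \<comment> \<open>Each of the two infima is exceeded by \<open>d\<close>; after multiplication by
    \<open>K\<close> the total slack is \<open>e\<close>.\<close>
  define d where "d = e / (2 * K)"
  have "0 < d" using \<open>0 < e\<close> K_ge_1 by (simp add: d_def)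
  then have "K * ((lux f + d) + (lux g + d)) \<in> admissible (\<lambda>x. f x + g x)"
    using f g by (intro admissible_add lux_less_admissible orlicz_spaceD) auto
  then have "lux (\<lambda>x. f x + g x) \<le> K * ((lux f + d) + (lux g + d))"
    using f g by (intro lux_le borel_measurable_add orlicz_spaceD)
  also have "\<dots> = K * (lux f + lux g) + e"
    using K_ge_1 by (simp add: d_def field_simps)
  finally show "lux (\<lambda>x. f x + g x) \<le> K * (lux f + lux g) + e" .
qed

lemma admissible_scale:
  assumes "c \<noteq> 0" "k \<in> admissible f"
  shows "\<bar>c\<bar> * k \<in> admissible (\<lambda>x. c * f x)"
proof -
  have "\<bar>c * y\<bar> / (\<bar>c\<bar> * k) = \<bar>y\<bar> / k" for y
    using assms(1) by (simp add: abs_mult)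
  then show ?thesis
    using assms by (simp add: admissible_def)
qed

lemma admissible_AE_zero:
  assumes f: "f \<in> borel_measurable M" and "AE x in M. f x = 0" and "0 < k"
  shows "k \<in> admissible f"
proof -
  have "AE x in M. \<Phi> (\<bar>f x\<bar> / k) \<le> 0"
    using assms(2) by (rule eventually_mono) (simp add: young_zero[OF young])
  then show ?thesis
    using admissible_dominated[OF f \<open>0 < k\<close> zero_mem, of 1] norm_scale[OF zero_mem, of 0] by simp
qed

lemma lux_AE_zero:
  assumes f: "f \<in> borel_measurable M" and "AE x in M. f x = 0"
  shows "f \<in> XPhi" "lux f = 0"
proof -
  have adm: "k \<in> admissible f" if "0 < k" for k
    using admissible_AE_zero assms that by blast
  show "f \<in> XPhi" using orlicz_spaceI[OF f adm[of 1]] by simp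
  then have "0 \<le> lux f" by (rule lux_nonneg)
  moreover have "lux f \<le> 0"
    by (rule field_le_epsilon) (use lux_le[OF f adm] in simp)
  ultimately show "lux f = 0" by simp
qed

text \<open>The case \<open>c = 0\<close> is separate because \<open>\<bar>c\<bar> * k\<close> must
  stay positive. Otherwise scaling admissible constants gives one inequality, and applying it to
  \<open>1 / c\<close> and \<open>c * f\<close> gives the other.\<close>

lemma orlicz_scale:
  assumes f: "f \<in> XPhi"
  shows "(\<lambda>x. c * f x) \<in> XPhi" "lux (\<lambda>x. c * f x) = \<bar>c\<bar> * lux f"
proof -
  have "(\<lambda>x. c * f x) \<in> XPhi \<and> lux (\<lambda>x. c * f x) = \<bar>c\<bar> * lux f"
  proof (cases "c = 0")
    case True
    then show ?thesis using lux_AE_zero[of "\<lambda>x. 0"] by simp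
  next
    case False
    have mem: "(\<lambda>x. d * g x) \<in> XPhi" and le: "lux (\<lambda>x. d * g x) \<le> \<bar>d\<bar> * lux g"
      if "d \<noteq> 0" "g \<in> XPhi" for d g
    proof -
      have meas: "(\<lambda>x. d * g x) \<in> borel_measurable M"
        using orlicz_spaceD[OF that(2)] by simp
      show "(\<lambda>x. d * g x) \<in> XPhi"
        using that meas admissible_scale[of d _ g] by (auto simp: orlicz_space_iff)
      show "lux (\<lambda>x. d * g x) \<le> \<bar>d\<bar> * lux g"
        using that by (intro lux_le_scaled[OF meas] admissible_scale) auto
    qed
    have "lux f \<le> \<bar>1 / c\<bar> * lux (\<lambda>x. c * f x)"
      using le[of "1 / c" "\<lambda>x. c * f x"] mem[OF False f] False by simp
    then have "\<bar>c\<bar> * lux f \<le> lux (\<lambda>x. c * f x)"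
      using False by (simp add: field_simps)
    then show ?thesis using le[OF False f] mem[OF False f] by simp
  qed
  then show "(\<lambda>x. c * f x) \<in> XPhi" "lux (\<lambda>x. c * f x) = \<bar>c\<bar> * lux f" by auto
qed

text \<open>If \<open>lux f = 0\<close>, then \<open>\<Phi> \<bar>f\<bar> \<le> s * \<Phi> (\<bar>f\<bar> / s)\<close> gives \<open>N (\<Phi> \<bar>f\<bar>) \<le> s\<close> for all \<open>s \<in> (0, 1)\<close>.\<close>

lemma lux_eq_0_imp:
  assumes f: "f \<in> XPhi" and "lux f = 0"
  shows "AE x in M. f x = 0"
proof -
  let ?F = "\<lambda>x. \<Phi> \<bar>f x\<bar>"
  have adm: "k \<in> admissible f" if "0 < k" for k
    using lux_less_admissible[OF f] assms(2) that by simp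
  have F: "?F \<in> X"
    using adm[of 1] by (simp add: admissible_def)
  have "N ?F \<le> s" if s: "0 < s" "s < 1" for s
  proof -
    have S: "(\<lambda>x. \<Phi> (\<bar>f x\<bar> / s)) \<in> X" "N (\<lambda>x. \<Phi> (\<bar>f x\<bar> / s)) \<le> 1"
      using adm[of s] s by (auto simp: admissible_def)
    have "\<bar>?F x\<bar> \<le> \<bar>s * \<Phi> (\<bar>f x\<bar> / s)\<bar>" for x
      using young_scale[OF young, of s "\<bar>f x\<bar> / s"] young_nonneg[OF young, of "\<bar>f x\<bar>"] s by simp
    then have "N ?F \<le> N (\<lambda>x. s * \<Phi> (\<bar>f x\<bar> / s))"
      using ideal(2)[OF measurable[OF F] scale_mem[OF S(1)]] by simp
    also have "\<dots> \<le> s"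
      using norm_scale[OF S(1)] S(2) s by (simp add: mult_le_cancel_left1)
    finally show ?thesis .
  qed
  then have "N ?F \<le> 0"
    by (intro dense_ge_bounded[of 0 1]) auto
  then have "AE x in M. ?F x = 0"
    using norm_nonneg[OF F] norm_eq_0_iff[OF F] by simp
  then show ?thesis
  proof (rule eventually_mono)
    show "f x = 0" if "\<Phi> \<bar>f x\<bar> = 0" for x
      using that young_pos[OF young, of "\<bar>f x\<bar>"] by fastforce
  qed
qed

lemma indicator_mem_orlicz: "indicator (space M) \<in> XPhi"
proof -
  have "\<Phi> \<bar>indicator (space M) x\<bar> = \<Phi> 1 * indicator (space M) x" for x
    by (simp add: indicator_def young_zero[OF young])
  then have "(\<lambda>x. \<Phi> \<bar>indicator (space M) x\<bar>) \<in> X"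
    using scale_mem[OF indicator_mem, of "\<Phi> 1"] by simp
  then have "(\<lambda>x. \<bar>indicator (space M) x\<bar> / 1) \<in> orlicz_class M \<Phi> X"
    using orlicz_class_iff[of "indicator (space M)" 1] by simp
  then show ?thesis
    unfolding orlicz_space_def by (auto intro!: exI[of _ 1])
qed

lemma orlicz_quasi_normed: "quasi_normed_function_space M XPhi lux"
  unfolding quasi_normed_function_space_def L0_subspace_def quasi_norm_on_def
proof (intro conjI ballI allI impI)
  show "\<exists>K\<ge>1. \<forall>f\<in>XPhi. \<forall>g\<in>XPhi. lux (\<lambda>x. f x + g x) \<le> K * (lux f + lux g)"
    using K_ge_1 lux_triangle by blast
  show "lux f = 0 \<longleftrightarrow> (AE x in M. f x = 0)" if "f \<in> XPhi" for f
    using lux_eq_0_imp[OF that] lux_AE_zero(2)[OF orlicz_spaceD[OF that]] by blast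
  show "(\<lambda>x. 0) \<in> XPhi"
    using lux_AE_zero(1)[of "\<lambda>x. 0"] by simp
qed (auto simp: orlicz_spaceD orlicz_add_mem orlicz_scale lux_nonneg indicator_mem_orlicz
      intro: orlicz_ideal)

text \<open>This makes closure under differences and \<open>Cauchy_subseq_limit\<close> available
  for the Orlicz space itself.\<close>

sublocale orlicz: qnfs M XPhi lux K
  using orlicz_quasi_normed K_ge_1 lux_triangle by unfold_locales

section \<open>Completeness\<close>

lemma orlicz_fast_Cauchy_limit:
  assumes complete: "quasi_norm_complete X N"
    and w: "\<And>i. w i \<in> XPhi"
    and fast: "\<And>i. lux (\<lambda>x. w (Suc i) x - w i x) < (1 / (2 * K)) ^ Suc i / 2 ^ i"
  shows "\<exists>f\<in>XPhi. (\<lambda>m. lux (\<lambda>x. w m x - f x)) \<longlonglongrightarrow> 0"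
proof -
  let ?c = "1 / (2 * K)"
  have c: "0 < ?c" "?c \<le> 1 / 2" using K_ge_1 by (auto simp: field_simps)
  \<comment> \<open>The divisor is the bound in \<open>fast\<close>, hence admissible for the
    increment; this is what gives \<open>N (\<Phi> (h i)) \<le> 1\<close>.\<close>
  define h where "h i x = \<bar>w (Suc i) x - w i x\<bar> / (?c ^ Suc i / 2 ^ i)" for i x
  have h_nonneg: "0 \<le> h i x" for i x
    using c by (simp add: h_def)
  have "?c ^ Suc i / 2 ^ i \<in> admissible (\<lambda>x. w (Suc i) x - w i x)" for i
    by (intro lux_less_admissible fast orlicz.diff_mem w)
  then have v: "(\<lambda>x. \<Phi> (h i x)) \<in> X" "N (\<lambda>x. \<Phi> (h i x)) \<le> 1" for i
    unfolding h_def admissible_def by auto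
  obtain S where S: "S \<in> X" "\<And>n. AE x in M. (\<Sum>i<n. ?c ^ Suc i * \<Phi> (h i x)) \<le> S x"
    using geometric_series_dominated[OF complete, of "\<lambda>i x. \<Phi> (h i x)"] v
      young_nonneg[OF young h_nonneg] by blast
  \<comment> \<open>Countably many null sets are merged, so that almost every \<open>x\<close>
    satisfies all the bounds at once.\<close>
  have "AE x in M. \<forall>n. (\<Sum>i<n. ?c ^ Suc i * \<Phi> (h i x)) \<le> S x"
    using S(2) by (simp add: AE_all_countable)
  then have increments: "AE x in M. \<forall>n. \<Phi> (\<Sum>i<n. 2 ^ i * \<bar>w (Suc i) x - w i x\<bar>) \<le> S x"
  proof (rule eventually_mono, intro allI)
    fix x n assume le: "\<forall>n. (\<Sum>i<n. ?c ^ Suc i * \<Phi> (h i x)) \<le> S x"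
    have "?c ^ Suc i * h i x = 2 ^ i * \<bar>w (Suc i) x - w i x\<bar>" for i
      using K_ge_1 by (simp add: h_def)
    then have "\<Phi> (\<Sum>i<n. 2 ^ i * \<bar>w (Suc i) x - w i x\<bar>) = \<Phi> (\<Sum>i<n. ?c ^ Suc i * h i x)"
      by simp
    also have "\<dots> \<le> (\<Sum>i<n. ?c ^ Suc i * \<Phi> (h i x))"
      using c h_nonneg by (intro young_geometric_sum[OF young]) auto
    also have "\<dots> \<le> S x" using le by blast
    finally show "\<Phi> (\<Sum>i<n. 2 ^ i * \<bar>w (Suc i) x - w i x\<bar>) \<le> S x" .
  qed
  \<comment> \<open>Where \<open>w\<close> diverges, \<open>lim\<close> has a default value;
    \<open>f\<close> is still measurable, and such points form a null set by
    \<open>increments\<close>.\<close>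
  define f where "f x = lim (\<lambda>m. w m x)" for x
  have f: "f \<in> borel_measurable M"
    unfolding f_def using w by (intro borel_measurable_lim_metric orlicz_spaceD)
  have diff_meas: "(\<lambda>x. w m x - f x) \<in> borel_measurable M" for m
    using f orlicz_spaceD[OF w] by measurable
  let ?B = "max 1 (N S)"
  \<comment> \<open>Since the dominating \<open>S\<close> does not depend on \<open>m\<close>,
    neither does \<open>?B\<close>, and the factor \<open>(1 / 2) ^ m\<close> alone forces
    convergence.\<close>
  have adm: "(1 / 2) ^ m * ?B \<in> admissible (\<lambda>x. w m x - f x)" for m
  proof (rule admissible_dominated[OF diff_meas _ S(1)])
    show "AE x in M. \<Phi> (\<bar>w m x - f x\<bar> / (1 / 2) ^ m) \<le> S x"
      using increments
    proof (rule eventually_mono)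
      fix x assume "\<forall>n. \<Phi> (\<Sum>i<n. 2 ^ i * \<bar>w (Suc i) x - w i x\<bar>) \<le> S x"
      then have "\<Phi> (2 ^ m * \<bar>f x - w m x\<bar>) \<le> S x"
        unfolding f_def by (intro young_weighted_increments_limit[OF young]) blast
      then show "\<Phi> (\<bar>w m x - f x\<bar> / (1 / 2) ^ m) \<le> S x"
        by (simp add: power_divide abs_minus_commute mult.commute)
    qed
  qed auto
  have diff_mem: "(\<lambda>x. w m x - f x) \<in> XPhi" for m
    using orlicz_spaceI[OF diff_meas adm] .
  \<comment> \<open>Here \<open>f\<close> is written as \<open>w 0 - (w 0 - f)\<close>.\<close>
  have "f \<in> XPhi"
    using orlicz.diff_mem[OF w[of 0] diff_mem[of 0]] by simp
  moreover have "(\<lambda>m. lux (\<lambda>x. w m x - f x)) \<longlonglongrightarrow> 0"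
  proof (rule tendsto_sandwich[OF _ _ tendsto_const])
    show "eventually (\<lambda>m. 0 \<le> lux (\<lambda>x. w m x - f x)) sequentially"
      using lux_nonneg[OF diff_mem] by simp
    show "eventually (\<lambda>m. lux (\<lambda>x. w m x - f x) \<le> (1 / 2) ^ m * ?B) sequentially"
      using lux_le[OF diff_meas adm] by simp
    have "(\<lambda>m. (1 / 2 :: real) ^ m * ?B) \<longlonglongrightarrow> 0 * ?B"
      by (intro tendsto_intros LIMSEQ_power_zero) auto
    then show "(\<lambda>m. (1 / 2) ^ m * ?B) \<longlonglongrightarrow> 0" by simp
  qed
  ultimately show ?thesis by blast
qed

lemma orlicz_complete:
  assumes complete: "quasi_norm_complete X N"
  shows "quasi_norm_complete XPhi lux"
  unfolding quasi_norm_complete_def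
proof (intro allI impI, elim conjE)
  fix u :: "nat \<Rightarrow> 'a \<Rightarrow> real"
  assume "\<forall>n. u n \<in> XPhi"
    and Cauchy: "\<forall>e>0. \<exists>n0. \<forall>m\<ge>n0. \<forall>n\<ge>n0. lux (\<lambda>x. u m x - u n x) < e"
  then have u: "u n \<in> XPhi" for n by blast
  let ?e = "\<lambda>i. (1 / (2 * K)) ^ Suc i / 2 ^ i"
  have "\<exists>n0. \<forall>m\<ge>n0. \<forall>n\<ge>n0. lux (\<lambda>x. u m x - u n x) < ?e i" for i
    using Cauchy K_ge_1 by simp
  then obtain n0 where n0:
    "\<And>i m n. n0 i \<le> m \<Longrightarrow> n0 i \<le> n \<Longrightarrow> lux (\<lambda>x. u m x - u n x) < ?e i"
    by metis
  \<comment> \<open>The sum puts \<open>r i\<close> beyond the threshold \<open>n0 i\<close>, and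
    the summand \<open>i\<close> makes \<open>r\<close> strictly increasing.\<close>
  define r where "r i = i + (\<Sum>j\<le>i. n0 j)" for i
  have "n0 i \<le> r i" for i
    unfolding r_def using member_le_sum[of i "{..i}" n0] by simp
  moreover have r: "strict_mono r"
    by (auto simp: r_def strict_mono_Suc_iff)
  ultimately have "lux (\<lambda>x. u (r (Suc i)) x - u (r i) x) < ?e i" for i
    using n0[of i "r (Suc i)" "r i"] strict_monoD[OF r, of i "Suc i"]
    by (metis lessI less_imp_le order_trans)
  then obtain f where f: "f \<in> XPhi" "(\<lambda>m. lux (\<lambda>x. u (r m) x - f x)) \<longlonglongrightarrow> 0"
    using orlicz_fast_Cauchy_limit[OF complete, of "\<lambda>i. u (r i)"] u by blast
  then have "(\<lambda>n. lux (\<lambda>x. u n x - f x)) \<longlonglongrightarrow> 0"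
    by (intro orlicz.Cauchy_subseq_limit[OF u f(1) r Cauchy[rule_format]])
  with f(1) show "\<exists>f\<in>XPhi. (\<lambda>n. lux (\<lambda>x. u n x - f x)) \<longlonglongrightarrow> 0" by blast
qed

end

theorem theorem4p11:
  fixes M :: "'a measure"
    and \<Phi> :: "real \<Rightarrow> real"
    and X :: "('a \<Rightarrow> real) set"
    and N :: "('a \<Rightarrow> real) \<Rightarrow> real"
  assumes "finite_measure M"
    and "young_function \<Phi>"
    and "quasi_banach_function_space M X N"
  shows "quasi_norm_complete (orlicz_space M \<Phi> X) (luxemburg_norm M \<Phi> X N) \<and>
         quasi_banach_function_space M (orlicz_space M \<Phi> X) (luxemburg_norm M \<Phi> X N)"
proof -
  have X: "quasi_normed_function_space M X N" and complete: "quasi_norm_complete X N"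
    using assms(3) by (auto simp: quasi_banach_function_space_def)
  then obtain K where "1 \<le> K"
    "\<And>f g. f \<in> X \<Longrightarrow> g \<in> X \<Longrightarrow> N (\<lambda>x. f x + g x) \<le> K * (N f + N g)"
    unfolding quasi_normed_function_space_def quasi_norm_on_def by blast
  then interpret orlicz M X N K \<Phi>
    using X assms(2) by unfold_locales
  show ?thesis
    using orlicz_complete[OF complete] orlicz_quasi_normed
    by (simp add: quasi_banach_function_space_def)
qed

end
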